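(* Let $(X,d)$ be a nonempty compact metric space, and let $T\colon X\to X$ be a continuous $P$-contractive mapping. Then $T$ is a Picard operator.
   Context: Let $(X,d)$ be a metric space. A map $T\colon X\to X$ is called $P$-contractive if $$d(Tx,Ty) < d(x,y)+\bigl|d(x,Tx)-d(y,Ty)\bigr|$$ for all distinct $x,y\in X$. A map $T\colon X\to X$ is called a Picard operator if it has a unique fixed point $z$, and $T^n x\to z$ as $n\to\infty$ for every $x\in X$, where $T^n$ denotes the $n$-fold iterate of $T$. *)

theory Defs
  imports "HOL-Analysis.Analysis"
begin

context Metric_space
begin

definition P_contractive :: "('a \<Rightarrow> 'a) \<Rightarrow> bool" where
  "P_contractive T \<longleftrightarrow> T \<in> M \<rightarrow> M \<and>
     (\<forall>x\<in>M. \<forall>y\<in>M. x \<noteq> y \<longrightarrow>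
        d (T x) (T y) < d x y + \<bar>d x (T x) - d y (T y)\<bar>)"

definition Picard_operator :: "('a \<Rightarrow> 'a) \<Rightarrow> bool" where
  "Picard_operator T \<longleftrightarrow> T \<in> M \<rightarrow> M \<and>
     (\<exists>z\<in>M. T z = z \<and> (\<forall>w\<in>M. T w = w \<longrightarrow> w = z) \<and>
        (\<forall>x\<in>M. limitin mtopology (\<lambda>n. (T ^^ n) x) z sequentially))"

end

end

(* Apply the condition to x and y = T x: if d (T x) (T (T x)) were at least d x (T x), the right-hand
   side would collapse to d (T x) (T (T x)) itself. So the displacement f x = d x (T x) strictly
   decreases along every orbit until a fixed point is reached, and f (T^n x) has a limit r. By
   compactness every subsequence of the orbit clusters at some l, and continuity gives
   f l = r = f (T l), which forces T l = l. Two fixed points have equal displacement 0, so they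
   coincide; hence the whole orbit converges to the unique fixed point. *)
theory Submission
  imports Defs
begin

context Metric_space
begin

lemma P_contractive_displacement_less:
  assumes "P_contractive T" "x \<in> M" "T x \<noteq> x"
  shows "d (T x) (T (T x)) < d x (T x)"
proof -
  have "T x \<in> M"
    using assms by (auto simp: P_contractive_def)
  then have "d (T x) (T (T x)) < d x (T x) + \<bar>d x (T x) - d (T x) (T (T x))\<bar>"
    using assms unfolding P_contractive_def by metis
  then show ?thesis
    by linarith
qed

lemma P_contractive_fixed_point_unique:
  assumes "P_contractive T" "z \<in> M" "w \<in> M" "T z = z" "T w = w"
  shows "w = z"
proof (rule ccontr)
  assume "w \<noteq> z"
  then have "d (T w) (T z) < d w z + \<bar>d w (T w) - d z (T z)\<bar>"
    using assms unfolding P_contractive_def by blast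
  then show False
    using assms by simp
qed

lemma P_contractive_orbit_in:
  assumes "P_contractive T" "x \<in> M"
  shows "(T ^^ n) x \<in> M"
  using assms by (induction n) (auto simp: P_contractive_def)

text \<open>An arbitrary \<open>s\<close> serves two ends: the identity yields a fixed point, and an
  \<open>s\<close> along which the orbit avoids a neighbourhood yields the contradiction that proves
  convergence.\<close>

lemma P_contractive_orbit_clusters_at_fixed_point:
  assumes T: "P_contractive T" and x: "x \<in> M"
    and compact: "compact_space mtopology"
    and cont: "continuous_map mtopology mtopology T"
    and s: "strict_mono s"
  obtains l r where "l \<in> M" "T l = l" "strict_mono (r :: nat \<Rightarrow> nat)"
    "limitin mtopology (\<lambda>n. (T ^^ s (r n)) x) l sequentially"
proof -
  define f where "f \<equiv> \<lambda>y. d y (T y)"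
  define g where "g \<equiv> \<lambda>n. (T ^^ n) x"
  have g_in: "g n \<in> M" for n
    unfolding g_def by (rule P_contractive_orbit_in[OF T x])
  have f_cont: "continuous_map mtopology euclidean f"
    using continuous_map_mdist[of mtopology Self "\<lambda>y. y" T] cont
    by (simp add: f_def mtopology_of_def)
  \<comment> \<open>Equality occurs only when \<open>g n\<close> is already fixed; both
    displacements are then 0.\<close>
  have "f (g (Suc n)) \<le> f (g n)" for n
    using P_contractive_displacement_less[OF T g_in[of n]]
    by (cases "T (g n) = g n") (auto simp: f_def g_def)
  then have "decseq (\<lambda>n. f (g n))"
    by (rule decseq_SucI)
  moreover have "0 \<le> f (g n)" for n
    by (simp add: f_def)
  \<comment> \<open>Convergence holds along the whole orbit, so every subsequence and its shift by
    one share the limit \<open>c\<close>.\<close>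
  ultimately obtain c where c: "(\<lambda>n. f (g n)) \<longlonglongrightarrow> c"
    using decseq_convergent[of "\<lambda>n. f (g n)" 0] by blast
  have "range (g \<circ> s) \<subseteq> M"
    using g_in by auto
  then obtain l r where l: "l \<in> M" and r: "strict_mono r"
    and lim: "limitin mtopology (g \<circ> s \<circ> r) l sequentially"
    using compact unfolding compact_space_sequentially by metis
  have sr: "strict_mono (s \<circ> r)"
    using s r by (rule strict_mono_o)
  \<comment> \<open>With \<open>h\<close> the identity and then \<open>T\<close>, this evaluates the
    limit at \<open>l\<close> and at \<open>T l\<close>.\<close>
  have lim_f: "(\<lambda>n. f (h (g (s (r n))))) \<longlonglongrightarrow> f (h l)"
    if "continuous_map mtopology mtopology h" for h
    using continuous_map_limit[OF continuous_map_compose[OF that f_cont] lim]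
    by (simp add: o_def)
  have "(\<lambda>n. f (g (s (r n)))) \<longlonglongrightarrow> c"
    using LIMSEQ_subseq_LIMSEQ[OF c sr] by (simp add: o_def)
  then have fl: "f l = c"
    using LIMSEQ_unique[OF lim_f[of "\<lambda>y. y"]] by simp
  \<comment> \<open>Applying \<open>T\<close> gives orbit index \<open>s (r n) + 1\<close>, not
    \<open>s (r (n + 1))\<close>, so the full sequence is shifted before the subsequence is
    taken.\<close>
  have "(\<lambda>n. f (T (g (s (r n))))) \<longlonglongrightarrow> c"
    using LIMSEQ_subseq_LIMSEQ[OF LIMSEQ_Suc[OF c] sr] by (simp add: o_def g_def)
  then have fTl: "f (T l) = c"
    by (rule LIMSEQ_unique[OF lim_f[OF cont]])
  have "T l = l"
    using P_contractive_displacement_less[OF T l] fl fTl by (auto simp: f_def)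
  with l r lim that show thesis
    by (simp add: o_def g_def)
qed

lemma P_contractive_imp_Picard_operator:
  assumes ne: "M \<noteq> {}" and compact: "compact_space mtopology"
    and cont: "continuous_map mtopology mtopology T" and T: "P_contractive T"
  shows "Picard_operator T"
proof -
  note cluster = P_contractive_orbit_clusters_at_fixed_point[OF T _ compact cont]
  obtain x\<^sub>0 where "x\<^sub>0 \<in> M"
    using ne by blast
  then obtain z where z: "z \<in> M" "T z = z"
    by (rule cluster[OF _ strict_mono_id])
  have "limitin mtopology (\<lambda>n. (T ^^ n) x) z sequentially" if x: "x \<in> M" for x
  proof (rule ccontr)
    assume "\<not> ?thesis"
    then obtain U where U: "openin mtopology U" "z \<in> U"
      and "\<not> (\<forall>\<^sub>F n in sequentially. (T ^^ n) x \<in> U)"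
      using z by (auto simp: limitin_def)
    \<comment> \<open>The orbit is outside \<open>U\<close> infinitely often. A limit along such
      times is a fixed point, hence \<open>z\<close>, which would force the orbit into
      \<open>U\<close>.\<close>
    then obtain s :: "nat \<Rightarrow> nat" where s: "strict_mono s" "\<And>n. (T ^^ s n) x \<notin> U"
      using not_eventually_sequentiallyD by blast
    obtain l r where l: "l \<in> M" "T l = l"
      and lim: "limitin mtopology (\<lambda>n. (T ^^ s (r n)) x) l sequentially"
      by (rule cluster[OF x s(1)])
    have "l = z"
      by (rule P_contractive_fixed_point_unique[OF T z(1) l(1) z(2) l(2)])
    then have "\<forall>\<^sub>F n in sequentially. (T ^^ s (r n)) x \<in> U"
      using lim U by (auto simp: limitin_def)
    then show False
      using s(2) by simp
  qed
  moreover have "\<forall>w\<in>M. T w = w \<longrightarrow> w = z"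
    using P_contractive_fixed_point_unique[OF T z(1) _ z(2)] by simp
  moreover have "T \<in> M \<rightarrow> M"
    using T by (simp add: P_contractive_def)
  ultimately show ?thesis
    using z unfolding Picard_operator_def by metis
qed

end

theorem theorem1:
  fixes X :: "'a set" and d :: "'a \<Rightarrow> 'a \<Rightarrow> real" and T :: "'a \<Rightarrow> 'a"
  assumes "Metric_space X d"
    and "X \<noteq> {}"
    and "compact_space (Metric_space.mtopology X d)"
    and "continuous_map (Metric_space.mtopology X d) (Metric_space.mtopology X d) T"
    and "Metric_space.P_contractive X d T"
  shows "Metric_space.Picard_operator X d T"
  using assms by (rule Metric_space.P_contractive_imp_Picard_operator)

end
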